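(* Let $\mathcal{B}$ be a full subcategory of the category $\mathcal{T}$ of all topological spaces such that every object of $\mathcal{B}$ is compact, all topological simplices $\Delta^n$ ($n\ge0$) are objects of $\mathcal{B}$, and the binary product in $\mathcal{T}$ of two objects of $\mathcal{B}$ is $\mathcal{B}$-generated. Then the forgetful functor $\omega_{\mathcal{B}}:\mathbf{Top}_{\mathcal{B}}\to\mathbf{Set}$ is topological and fibre-small.
   Context: Compact means quasi-compact and Hausdorff. A topological space $X$ is $\mathcal{B}$-generated if the natural map $\varinjlim_{B\to X,\,B\in\mathcal{B}}B\to X$ is a homeomorphism, i.e. $X$ carries the final topology with respect to all continuous maps $B\to X$ with $B\in\mathcal{B}$. $\mathbf{Top}_{\mathcal{B}}$ is the full subcategory of $\mathcal{T}$ of $\mathcal{B}$-generated spaces, and $\omega_{\mathcal{B}}$ sends a space to its underlying set. A functor $U:\mathcal{A}\to\mathcal{X}$ is topological (in the sense of Adámek–Herrlich–Strecker) if every $U$-structured source $(E\to U(A_i))_{i\in I}$ ($I$ a possibly large class) has a unique $U$-initial lift; equivalently, every $U$-structured sink has a unique $U$-final lift. It is fibre-small if for each object $E$ of $\mathcal{X}$ the fibre of $U$ over $E$ is a set. *)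

theory Defs
  imports "HOL-Homology.Simplices" "HOL-Library.FuncSet" "HOL-Library.Equipollence"
begin

section \<open>Sets and classes\<close>

text \<open>
  The distinction between sets and proper classes is rendered by a Grothendieck universe inside a
  type: \<open>\<U>\<close> collects the subsets of the type \<^typ>\<open>'u\<close> that count as sets, and every collection
  equipollent to a member of \<open>\<U>\<close> counts as a set too. The collections over arbitrary types are the
  classes. The intended model is a type of all ZFC sets, with \<open>\<U>\<close> the collections that are
  the extension of a set; more generally, for an inaccessible cardinal \<open>\<kappa>\<close> and \<^typ>\<open>'u\<close> of
  cardinality at least \<open>\<kappa>\<close>, the subsets of cardinality below \<open>\<kappa>\<close>.
\<close>

definition set_universe :: "'u set set \<Rightarrow> bool" where
  "set_universe \<U> \<longleftrightarrow>
     (\<exists>S\<in>\<U>. infinite S) \<and>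
     (\<forall>S\<in>\<U>. \<forall>T. T \<subseteq> S \<longrightarrow> T \<in> \<U>) \<and>
     (\<forall>S\<in>\<U>. \<forall>T. T \<approx> S \<longrightarrow> T \<in> \<U>) \<and>
     (\<forall>S\<in>\<U>. \<exists>T\<in>\<U>. Pow S \<approx> T) \<and>
     (\<forall>S\<in>\<U>. \<forall>F. (\<forall>x\<in>S. F x \<in> \<U>) \<longrightarrow> (\<Union>x\<in>S::'u set. F x) \<in> \<U>)"

definition small_wrt :: "'u set set \<Rightarrow> 'x set \<Rightarrow> bool" where
  "small_wrt \<U> X \<longleftrightarrow> (\<exists>S\<in>\<U>. X \<approx> S)"


section \<open>Categories and functors\<close>

text \<open>
  Hom-sets of different pairs of objects need not be disjoint, so composition, identities and the
  action of a functor on morphisms carry the objects as arguments: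
  \<open>Comp C X Y Z g f\<close> is the composite of \<open>f : X \<rightarrow> Y\<close> and \<open>g : Y \<rightarrow> Z\<close>.
\<close>

record ('o, 'm) precategory =
  Obj :: "'o set"
  Hom :: "'o \<Rightarrow> 'o \<Rightarrow> 'm set"
  Id :: "'o \<Rightarrow> 'm"
  Comp :: "'o \<Rightarrow> 'o \<Rightarrow> 'o \<Rightarrow> 'm \<Rightarrow> 'm \<Rightarrow> 'm"

definition category :: "('o, 'm) precategory \<Rightarrow> bool" where
  "category C \<longleftrightarrow>
     (\<forall>X\<in>Obj C. Id C X \<in> Hom C X X) \<and>
     (\<forall>X\<in>Obj C. \<forall>Y\<in>Obj C. \<forall>Z\<in>Obj C. \<forall>f\<in>Hom C X Y. \<forall>g\<in>Hom C Y Z.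
        Comp C X Y Z g f \<in> Hom C X Z) \<and>
     (\<forall>X\<in>Obj C. \<forall>Y\<in>Obj C. \<forall>f\<in>Hom C X Y.
        Comp C X X Y f (Id C X) = f \<and> Comp C X Y Y (Id C Y) f = f) \<and>
     (\<forall>W\<in>Obj C. \<forall>X\<in>Obj C. \<forall>Y\<in>Obj C. \<forall>Z\<in>Obj C.
      \<forall>f\<in>Hom C W X. \<forall>g\<in>Hom C X Y. \<forall>h\<in>Hom C Y Z.
        Comp C W X Z (Comp C X Y Z h g) f = Comp C W Y Z h (Comp C W X Y g f))"

definition full_subcategory_on ::
  "('o, 'm) precategory \<Rightarrow> 'o set \<Rightarrow> ('o, 'm) precategory" where
  "full_subcategory_on C P = C\<lparr>Obj := Obj C \<inter> P\<rparr>"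

record ('o, 'm, 'p, 'n) prefunctor =
  FObj :: "'o \<Rightarrow> 'p"
  FArr :: "'o \<Rightarrow> 'o \<Rightarrow> 'm \<Rightarrow> 'n"

definition is_functor ::
  "('o, 'm) precategory \<Rightarrow> ('p, 'n) precategory \<Rightarrow> ('o, 'm, 'p, 'n) prefunctor \<Rightarrow> bool" where
  "is_functor A X U \<longleftrightarrow> category A \<and> category X \<and>
     (\<forall>a\<in>Obj A. FObj U a \<in> Obj X) \<and>
     (\<forall>a\<in>Obj A. \<forall>b\<in>Obj A. \<forall>f\<in>Hom A a b. FArr U a b f \<in> Hom X (FObj U a) (FObj U b)) \<and>
     (\<forall>a\<in>Obj A. FArr U a a (Id A a) = Id X (FObj U a)) \<and>
     (\<forall>a\<in>Obj A. \<forall>b\<in>Obj A. \<forall>c\<in>Obj A. \<forall>f\<in>Hom A a b. \<forall>g\<in>Hom A b c.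
        FArr U a c (Comp A a b c g f) =
        Comp X (FObj U a) (FObj U b) (FObj U c) (FArr U b c g) (FArr U a b f))"


section \<open>Topological functors\<close>

definition structured_source ::
  "('o, 'm) precategory \<Rightarrow> ('p, 'n) precategory \<Rightarrow> ('o, 'm, 'p, 'n) prefunctor \<Rightarrow>
   'p \<Rightarrow> 'i set \<Rightarrow> ('i \<Rightarrow> 'o) \<Rightarrow> ('i \<Rightarrow> 'n) \<Rightarrow> bool" where
  "structured_source A X U E I D g \<longleftrightarrow>
     E \<in> Obj X \<and> (\<forall>i\<in>I. D i \<in> Obj A \<and> g i \<in> Hom X E (FObj U (D i)))"

definition initial_source ::
  "('o, 'm) precategory \<Rightarrow> ('p, 'n) precategory \<Rightarrow> ('o, 'm, 'p, 'n) prefunctor \<Rightarrow>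
   'o \<Rightarrow> 'i set \<Rightarrow> ('i \<Rightarrow> 'o) \<Rightarrow> ('i \<Rightarrow> 'm) \<Rightarrow> bool" where
  "initial_source A X U L I D f \<longleftrightarrow>
     L \<in> Obj A \<and> (\<forall>i\<in>I. D i \<in> Obj A \<and> f i \<in> Hom A L (D i)) \<and>
     (\<forall>c\<in>Obj A. \<forall>h. \<forall>k\<in>Hom X (FObj U c) (FObj U L).
        (\<forall>i\<in>I. h i \<in> Hom A c (D i) \<and>
               FArr U c (D i) (h i) =
               Comp X (FObj U c) (FObj U L) (FObj U (D i)) (FArr U L (D i) (f i)) k) \<longrightarrow>
        (\<exists>!l. l \<in> Hom A c L \<and> FArr U c L l = k \<and>
              (\<forall>i\<in>I. h i = Comp A c L (D i) (f i) l)))"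

text \<open>
  The family of morphisms of a lift is taken in \<^term>\<open>extensional I\<close>, so that two lifts are equal
  as soon as they agree on \<open>I\<close>.
\<close>

definition initial_lift ::
  "('o, 'm) precategory \<Rightarrow> ('p, 'n) precategory \<Rightarrow> ('o, 'm, 'p, 'n) prefunctor \<Rightarrow>
   'p \<Rightarrow> 'i set \<Rightarrow> ('i \<Rightarrow> 'o) \<Rightarrow> ('i \<Rightarrow> 'n) \<Rightarrow> 'o \<times> ('i \<Rightarrow> 'm) \<Rightarrow> bool" where
  "initial_lift A X U E I D g = (\<lambda>(L, f).
     initial_source A X U L I D f \<and> f \<in> extensional I \<and>
     FObj U L = E \<and> (\<forall>i\<in>I. FArr U L (D i) (f i) = g i))"

text \<open>
  A definition cannot quantify over types, so the type \<^typ>\<open>'i\<close> over which the index classes range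
  is a parameter; statements leave it free and thereby cover index classes of every size.
\<close>

definition topological_functor ::
  "'i itself \<Rightarrow> ('o, 'm) precategory \<Rightarrow> ('p, 'n) precategory \<Rightarrow>
   ('o, 'm, 'p, 'n) prefunctor \<Rightarrow> bool" where
  "topological_functor (_ :: 'i itself) A X U \<longleftrightarrow>
     is_functor A X U \<and>
     (\<forall>E. \<forall>I :: 'i set. \<forall>D g. structured_source A X U E I D g \<longrightarrow>
        (\<exists>!lift. initial_lift A X U E I D g lift))"

definition fibre_small ::
  "'u set set \<Rightarrow> ('o, 'm) precategory \<Rightarrow> ('p, 'n) precategory \<Rightarrow>
   ('o, 'm, 'p, 'n) prefunctor \<Rightarrow> bool" where
  "fibre_small \<U> A X U \<longleftrightarrow> (\<forall>E\<in>Obj X. small_wrt \<U> {a \<in> Obj A. FObj U a = E})"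


section \<open>Sets, topological spaces and \<open>\<B>\<close>-generated spaces\<close>

definition Set_cat :: "'u set set \<Rightarrow> ('u set, 'u \<Rightarrow> 'u) precategory" where
  "Set_cat \<U> =
     \<lparr>Obj = \<U>,
      Hom = (\<lambda>E F. E \<rightarrow>\<^sub>E F),
      Id = (\<lambda>E. \<lambda>x\<in>E. x),
      Comp = (\<lambda>E F G g f. compose E g f)\<rparr>"

definition Top_cat :: "'u set set \<Rightarrow> ('u topology, 'u \<Rightarrow> 'u) precategory" where
  "Top_cat \<U> =
     \<lparr>Obj = {X. topspace X \<in> \<U>},
      Hom = (\<lambda>X Y. {f \<in> extensional (topspace X). continuous_map X Y f}),
      Id = (\<lambda>X. \<lambda>x\<in>topspace X. x),
      Comp = (\<lambda>X Y Z g f. compose (topspace X) g f)\<rparr>"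

text \<open>
  \<open>X\<close> may live over a different type than the members of \<open>\<B>\<close>, so that the notion applies to
  products, whose points are pairs.
\<close>

definition generated_by :: "'u topology set \<Rightarrow> 'x topology \<Rightarrow> bool" where
  "generated_by \<B> X \<longleftrightarrow>
     (\<forall>V \<subseteq> topspace X. openin X V \<longleftrightarrow>
        (\<forall>B\<in>\<B>. \<forall>f. continuous_map B X f \<longrightarrow> openin B {b \<in> topspace B. f b \<in> V}))"

definition Top_gen ::
  "'u set set \<Rightarrow> 'u topology set \<Rightarrow> ('u topology, 'u \<Rightarrow> 'u) precategory" where
  "Top_gen \<U> \<B> = full_subcategory_on (Top_cat \<U>) {X. generated_by \<B> X}"

definition forget_gen :: "('u topology, 'u \<Rightarrow> 'u, 'u set, 'u \<Rightarrow> 'u) prefunctor" where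
  "forget_gen = \<lparr>FObj = topspace, FArr = (\<lambda>X Y f. f)\<rparr>"

abbreviation top_simplex :: "nat \<Rightarrow> (nat \<Rightarrow> real) topology" where
  "top_simplex n \<equiv> subtopology (powertop_real UNIV) (standard_simplex n)"

end

theory Submission
  imports Defs
begin

text \<open>
  Declare \<open>f : B \<rightarrow> E\<close> with \<open>B \<in> \<B>\<close> a probe of a structured source \<open>g\<^sub>i : E \<rightarrow> D\<^sub>i\<close> if
  every \<open>g\<^sub>i \<circ> f\<close> is continuous, and give \<open>E\<close> the final topology with respect to all
  probes. A map out of a \<open>\<B>\<close>-generated space is continuous as soon as its restrictions along the
  maps from members of \<open>\<B>\<close> are, which makes this topology initial.
\<close>

section \<open>The categories and the forgetful functor\<close>

lemma category_Set_cat: "category (Set_cat \<U>)"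
proof -
  \<comment> \<open>Splitting \<open>E \<rightarrow>\<^sub>E F\<close> into its two conditions puts
    every goal in the shape of a library rule on \<open>compose\<close> and
    \<open>restrict\<close>.\<close>
  have sel:
    "f \<in> Hom (Set_cat \<U>) E F \<longleftrightarrow> f \<in> E \<rightarrow> F \<and> f \<in> extensional E"
    "Id (Set_cat \<U>) E = (\<lambda>x\<in>E. x)"
    "Comp (Set_cat \<U>) E F G g f = compose E g f" for E F G g f
    by (simp_all add: Set_cat_def PiE_def)
  show ?thesis
    unfolding category_def
  proof ((intro conjI ballI, unfold sel); ((elim conjE)?, (intro conjI)?))
    fix E F G :: "'a set" and f g
    assume "f \<in> E \<rightarrow> F" "g \<in> F \<rightarrow> G"
    then show "compose E g f \<in> E \<rightarrow> G"
      by (rule funcset_compose)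
  next
    fix E :: "'a set" show "(\<lambda>x\<in>E. x) \<in> E \<rightarrow> E" by simp
  qed (rule restrict_extensional compose_extensional compose_Id Id_compose compose_assoc[symmetric];
      assumption)+
qed

lemma category_Top_gen: "category (Top_gen \<U> \<B>)"
proof -
  \<comment> \<open>Morphisms are extensional, so composites and identities are cut off outside the
    carrier; they agree there with the plain maps, and continuity sees nothing else.\<close>
  have comp: "continuous_map X Z (compose (topspace X) g f)"
    if "continuous_map X Y f" "continuous_map Y Z g" for X Y Z :: "'u topology" and f g
    using continuous_map_compose[OF that] by (rule continuous_map_eq) (simp add: compose_def)
  have id: "continuous_map X X (\<lambda>x\<in>topspace X. x)" for X :: "'u topology"
    by (rule continuous_map_eq[OF continuous_map_id]) simp
  have unit: "compose (topspace X) f (\<lambda>x\<in>topspace X. x) = f"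
    "compose (topspace X) (\<lambda>y\<in>topspace Y. y) f = f"
    if "f \<in> extensional (topspace X)" "continuous_map X Y f" for X Y :: "'u topology" and f
    using compose_Id[OF continuous_map_funspace[OF that(2)] that(1)]
      Id_compose[OF continuous_map_funspace[OF that(2)] that(1)] .
  have assoc: "compose (topspace W) (compose (topspace X) h g) f =
      compose (topspace W) h (compose (topspace W) g f)"
    if "continuous_map W X f" for W X :: "'u topology" and f g h :: "'u \<Rightarrow> 'u"
    using compose_assoc[OF continuous_map_funspace[OF that]] by (rule sym)
  have sel:
    "f \<in> Hom (Top_gen \<U> \<B>) X Y \<longleftrightarrow> f \<in> extensional (topspace X) \<and> continuous_map X Y f"
    "Id (Top_gen \<U> \<B>) X = (\<lambda>x\<in>topspace X. x)"
    "Comp (Top_gen \<U> \<B>) X Y Z g f = compose (topspace X) g f" for X Y Z f g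
    by (simp_all add: Top_gen_def full_subcategory_on_def Top_cat_def)
  show ?thesis
    unfolding category_def
  proof ((intro conjI ballI, unfold sel); ((elim conjE)?, (intro conjI)?))
    fix X Y Z :: "'u topology" and f g
    assume "continuous_map X Y f" "continuous_map Y Z g"
    then show "continuous_map X Z (compose (topspace X) g f)"
      by (rule comp)
  qed (rule restrict_extensional compose_extensional id unit assoc; assumption)+
qed

lemma is_functor_forget_gen: "is_functor (Top_gen \<U> \<B>) (Set_cat \<U>) forget_gen"
  unfolding is_functor_def
  using category_Set_cat category_Top_gen
  by (auto simp: Top_gen_def full_subcategory_on_def Top_cat_def Set_cat_def forget_gen_def PiE_iff
      dest: continuous_map_funspace)

section \<open>Generated spaces and final topologies\<close>

lemma generated_byI:
  assumes "\<And>V. V \<subseteq> topspace X \<Longrightarrow>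
    (\<And>B f. B \<in> \<B> \<Longrightarrow> continuous_map B X f \<Longrightarrow> openin B {b \<in> topspace B. f b \<in> V}) \<Longrightarrow> openin X V"
  shows "generated_by \<B> X"
  \<comment> \<open>The other implication always holds, because preimages of open sets along
    continuous maps are open.\<close>
  unfolding generated_by_def using assms by (blast intro: openin_continuous_map_preimage)

lemma continuous_map_from_generated:
  assumes gen: "generated_by \<B> X" and k: "k \<in> topspace X \<rightarrow> topspace Y"
    and probe: "\<And>B f. B \<in> \<B> \<Longrightarrow> continuous_map B X f \<Longrightarrow> continuous_map B Y (k \<circ> f)"
  shows "continuous_map X Y k"
  unfolding continuous_map_def
proof (intro conjI allI impI k)
  fix W assume W: "openin Y W"
  \<comment> \<open>Pulling back along \<open>k\<close> and then along \<open>f\<close> is pulling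
    back along \<open>k \<circ> f\<close>, which is continuous by \<open>probe\<close>.\<close>
  have "openin B {b \<in> topspace B. f b \<in> {x \<in> topspace X. k x \<in> W}}"
    if "B \<in> \<B>" "continuous_map B X f" for B f
  proof -
    have "{b \<in> topspace B. f b \<in> {x \<in> topspace X. k x \<in> W}} = {b \<in> topspace B. (k \<circ> f) b \<in> W}"
      using continuous_map_funspace[OF that(2)] by auto
    then show ?thesis
      using openin_continuous_map_preimage[OF probe[OF that] W] by simp
  qed
  moreover have "{x \<in> topspace X. k x \<in> W} \<subseteq> topspace X" by auto
  ultimately show "openin X {x \<in> topspace X. k x \<in> W}"
    using gen unfolding generated_by_def by blast
qed

definition final_topology :: "'b set \<Rightarrow> ('a topology \<times> ('a \<Rightarrow> 'b)) set \<Rightarrow> 'b topology" where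
  "final_topology E P = topology (\<lambda>V. V \<subseteq> E \<and>
     (\<forall>(B, f)\<in>P. openin B {b \<in> topspace B. f b \<in> V}))"

text \<open>Taking preimages commutes with intersections and unions, so the defining predicate
  really is a topology and \<open>topology\<close> returns it unchanged.\<close>

lemma openin_final_topology:
  fixes P :: "('a topology \<times> ('a \<Rightarrow> 'b)) set"
  shows "openin (final_topology E P) V \<longleftrightarrow>
     V \<subseteq> E \<and> (\<forall>(B, f)\<in>P. openin B {b \<in> topspace B. f b \<in> V})"
proof -
  have "istopology (\<lambda>V. V \<subseteq> E \<and> (\<forall>(B, f)\<in>P. openin B {b \<in> topspace B. f b \<in> V}))"
    unfolding istopology_def
  proof (intro conjI allI impI)
    fix S T
    assume "S \<subseteq> E \<and> (\<forall>(B, f)\<in>P. openin B {b \<in> topspace B. f b \<in> S})"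
      and "T \<subseteq> E \<and> (\<forall>(B, f)\<in>P. openin B {b \<in> topspace B. f b \<in> T})"
    moreover have "{b \<in> topspace B. f b \<in> S \<inter> T} =
        {b \<in> topspace B. f b \<in> S} \<inter> {b \<in> topspace B. f b \<in> T}" for B and f :: "'a \<Rightarrow> 'b"
      by auto
    ultimately show "S \<inter> T \<subseteq> E" "\<forall>(B, f)\<in>P. openin B {b \<in> topspace B. f b \<in> S \<inter> T}"
      by (auto simp del: Int_iff)
  next
    fix \<K> assume K: "\<forall>V\<in>\<K>. V \<subseteq> E \<and> (\<forall>(B, f)\<in>P. openin B {b \<in> topspace B. f b \<in> V})"
    then show "\<Union> \<K> \<subseteq> E" by blast
    have "{b \<in> topspace B. f b \<in> \<Union> \<K>} = (\<Union>V\<in>\<K>. {b \<in> topspace B. f b \<in> V})"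
      for B and f :: "'a \<Rightarrow> 'b"
      by auto
    with K show "\<forall>(B, f)\<in>P. openin B {b \<in> topspace B. f b \<in> \<Union> \<K>}"
      by (auto simp del: Union_iff intro!: openin_Union)
  qed
  then show ?thesis
    unfolding final_topology_def by (simp add: topology_inverse')
qed

text \<open>\<open>E\<close> is open because its preimage under a map into \<open>E\<close> is the
  whole domain; a map leaving \<open>E\<close> could spoil this.\<close>

lemma topspace_final_topology:
  assumes "\<And>B f. (B, f) \<in> P \<Longrightarrow> f \<in> topspace B \<rightarrow> E"
  shows "topspace (final_topology E P) = E"
proof
  show "topspace (final_topology E P) \<subseteq> E"
    by (metis openin_final_topology openin_topspace)
  have "{b \<in> topspace B. f b \<in> E} = topspace B" if "(B, f) \<in> P" for B f
    using assms[OF that] by auto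
  then have "openin (final_topology E P) E"
    by (auto simp: openin_final_topology)
  then show "E \<subseteq> topspace (final_topology E P)"
    by (rule openin_subset)
qed

section \<open>The initial topology among \<B>-generated spaces\<close>

definition probes ::
  "'u topology set \<Rightarrow> 'e set \<Rightarrow> 'i set \<Rightarrow> ('i \<Rightarrow> 'x topology) \<Rightarrow> ('i \<Rightarrow> 'e \<Rightarrow> 'x) \<Rightarrow>
   ('u topology \<times> ('u \<Rightarrow> 'e)) set" where
  "probes \<B> E I D g = {(B, f). B \<in> \<B> \<and> f \<in> topspace B \<rightarrow> E \<and>
     (\<forall>i\<in>I. continuous_map B (D i) (g i \<circ> f))}"

text \<open>When each \<open>g i\<close> maps \<open>E\<close> into \<open>topspace (D i)\<close>,
  the probes are exactly the maps continuous for the usual initial topology on \<open>E\<close>. The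
  result is then the \<B>-generated refinement of that topology, as in k-ification. The class
  \<open>I\<close> enters only through a conjunction, so its size is irrelevant.\<close>

abbreviation initial_topology ::
  "'u topology set \<Rightarrow> 'e set \<Rightarrow> 'i set \<Rightarrow> ('i \<Rightarrow> 'x topology) \<Rightarrow> ('i \<Rightarrow> 'e \<Rightarrow> 'x) \<Rightarrow>
   'e topology" where
  "initial_topology \<B> E I D g \<equiv> final_topology E (probes \<B> E I D g)"

lemma topspace_initial_topology [simp]: "topspace (initial_topology \<B> E I D g) = E"
  by (rule topspace_final_topology) (simp add: probes_def)

lemma continuous_map_probe:
  assumes "(B, f) \<in> probes \<B> E I D g"
  shows "continuous_map B (initial_topology \<B> E I D g) f"
  using assms by (auto simp: continuous_map_def openin_final_topology) (auto simp: probes_def)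

text \<open>Probes are among the continuous maps from members of \<B>, so a set that passes the test
  for all such maps passes it for the probes, which define the topology.\<close>

lemma generated_by_initial_topology: "generated_by \<B> (initial_topology \<B> E I D g)"
proof (rule generated_byI)
  fix V
  assume V: "V \<subseteq> topspace (initial_topology \<B> E I D g)"
    and *: "\<And>B f. B \<in> \<B> \<Longrightarrow> continuous_map B (initial_topology \<B> E I D g) f \<Longrightarrow>
      openin B {b \<in> topspace B. f b \<in> V}"
  have "openin B {b \<in> topspace B. f b \<in> V}" if "(B, f) \<in> probes \<B> E I D g" for B f
    using that by (intro * continuous_map_probe) (simp_all add: probes_def)
  with V show "openin (initial_topology \<B> E I D g) V"
    by (auto simp: openin_final_topology)
qed

lemma continuous_map_from_initial_topology:
  assumes "i \<in> I" and gi: "g i \<in> E \<rightarrow> topspace (D i)"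
  shows "continuous_map (initial_topology \<B> E I D g) (D i) (g i)"
  unfolding continuous_map_def
proof (intro conjI allI impI)
  show "g i \<in> topspace (initial_topology \<B> E I D g) \<rightarrow> topspace (D i)"
    using gi by simp
  fix W assume W: "openin (D i) W"
  have "openin B {b \<in> topspace B. f b \<in> {x \<in> E. g i x \<in> W}}"
    if "(B, f) \<in> probes \<B> E I D g" for B f
  proof -
    \<comment> \<open>On a probe, the test for the preimage of \<open>W\<close> becomes openness of
      its preimage under \<open>g i \<circ> f\<close>, continuous by the choice of probes.\<close>
    have "{b \<in> topspace B. f b \<in> {x \<in> E. g i x \<in> W}} = {b \<in> topspace B. (g i \<circ> f) b \<in> W}"
      using that by (auto simp: probes_def)
    moreover have "continuous_map B (D i) (g i \<circ> f)"
      using that \<open>i \<in> I\<close> by (simp add: probes_def)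
    ultimately show ?thesis
      using openin_continuous_map_preimage[OF _ W] by metis
  qed
  then show "openin (initial_topology \<B> E I D g) {x \<in> topspace (initial_topology \<B> E I D g). g i x \<in> W}"
    unfolding topspace_initial_topology openin_final_topology by blast
qed

lemma continuous_map_into_initial_topology:
  assumes "generated_by \<B> X" and k: "k \<in> topspace X \<rightarrow> E"
    and "\<And>i. i \<in> I \<Longrightarrow> continuous_map X (D i) (g i \<circ> k)"
  shows "continuous_map X (initial_topology \<B> E I D g) k"
proof (rule continuous_map_from_generated[OF assms(1)])
  show "k \<in> topspace X \<rightarrow> topspace (initial_topology \<B> E I D g)"
    using k by simp
  fix B f assume B: "B \<in> \<B>" and f: "continuous_map B X f"
  have "continuous_map B (D i) (g i \<circ> (k \<circ> f))" if "i \<in> I" for i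
    using continuous_map_compose[OF f assms(3)[OF that]] by (simp add: comp_assoc)
  \<comment> \<open>This is the universal property: maps from members of \<B> into \<open>X\<close>,
    followed by \<open>k\<close>, are themselves probes.\<close>
  then have "(B, k \<circ> f) \<in> probes \<B> E I D g"
    using B k continuous_map_funspace[OF f] by (auto simp: probes_def)
  then show "continuous_map B (initial_topology \<B> E I D g) (k \<circ> f)"
    by (rule continuous_map_probe)
qed

section \<open>Initial lifts in terms of continuity\<close>

lemma initial_lift_forget_gen_iff:
  "initial_lift (Top_gen \<U> \<B>) (Set_cat \<U>) forget_gen E I D g (L, f) \<longleftrightarrow>
     topspace L = E \<and> E \<in> \<U> \<and> generated_by \<B> L \<and> f = restrict g I \<and>
     (\<forall>i\<in>I. topspace (D i) \<in> \<U> \<and> generated_by \<B> (D i) \<and>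
       g i \<in> extensional E \<and> continuous_map L (D i) (g i)) \<and>
     (\<forall>c k. topspace c \<in> \<U> \<and> generated_by \<B> c \<and> k \<in> topspace c \<rightarrow>\<^sub>E E \<and>
       (\<forall>i\<in>I. continuous_map c (D i) (g i \<circ> k)) \<longrightarrow> continuous_map c L k)"
  (is "?lift \<longleftrightarrow> ?R")
proof -
  have comp: "continuous_map c Y (compose (topspace c) u k) \<longleftrightarrow> continuous_map c Y (u \<circ> k)"
    for c Y :: "'a topology" and u k :: "'a \<Rightarrow> 'a"
    by (auto simp: compose_def elim!: continuous_map_eq)
  \<comment> \<open>The functor fixes arrows, so the arrows of a lift agree with \<open>g\<close> on
    \<open>I\<close>, and extensionality fixes them elsewhere.\<close>
  have f: "f \<in> extensional I \<and> (\<forall>i\<in>I. f i = g i) \<longleftrightarrow> f = restrict g I"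
    by (auto simp: extensional_def restrict_def)
  note defs = initial_lift_def initial_source_def Top_gen_def full_subcategory_on_def Top_cat_def
    Set_cat_def forget_gen_def
  show ?thesis
  proof
    assume L: ?lift
    then have eq: "topspace L = E" "f = restrict g I"
      using f by (auto simp: defs)
    have "continuous_map c L k"
      if "topspace c \<in> \<U>" "generated_by \<B> c" "k \<in> topspace c \<rightarrow>\<^sub>E E"
        "\<forall>i\<in>I. continuous_map c (D i) (g i \<circ> k)" for c k
    proof -
      \<comment> \<open>The universal property is applied to the composites of \<open>k\<close> with
        the \<open>g i\<close>. As the functor fixes arrows, \<open>l\<close> can only be
        \<open>k\<close>, and all that is gained is the continuity of \<open>k\<close>.\<close>
      have "\<exists>!l. (l \<in> extensional (topspace c) \<and> continuous_map c L l) \<and> l = k \<and>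
          (\<forall>i\<in>I. compose (topspace c) (g i) k = compose (topspace c) (f i) l)"
        using L that eq comp
        by (auto simp: defs dest!: bspec[of _ _ k] spec[of _ "\<lambda>i. compose (topspace c) (g i) k"] spec[of _ c])
      then show ?thesis by auto
    qed
    then show ?R
      using L eq by (auto simp: defs)
  next
    assume R: ?R
    then show ?lift
      by (auto simp: defs PiE_iff) (metis comp)
  qed
qed

lemma topological_functor_forget_gen:
  "topological_functor TYPE('i) (Top_gen \<U> \<B>) (Set_cat \<U>) forget_gen"
  unfolding topological_functor_def
proof (intro conjI allI impI is_functor_forget_gen)
  fix E :: "'a set" and I :: "'i set" and D :: "'i \<Rightarrow> 'a topology" and g :: "'i \<Rightarrow> 'a \<Rightarrow> 'a"
  assume "structured_source (Top_gen \<U> \<B>) (Set_cat \<U>) forget_gen E I D g"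
  then have E: "E \<in> \<U>" and
    src: "\<And>i. i \<in> I \<Longrightarrow> topspace (D i) \<in> \<U> \<and> generated_by \<B> (D i) \<and> g i \<in> E \<rightarrow>\<^sub>E topspace (D i)"
    by (auto simp: structured_source_def Top_gen_def full_subcategory_on_def Top_cat_def
        Set_cat_def forget_gen_def)
  let ?lift = "initial_lift (Top_gen \<U> \<B>) (Set_cat \<U>) forget_gen E I D g"
  show "\<exists>!lift. ?lift lift"
  proof (rule ex_ex1I)
    \<comment> \<open>Existence: the topology built from the probes carries the lift.\<close>
    have "?lift (initial_topology \<B> E I D g, restrict g I)"
      unfolding initial_lift_forget_gen_iff
      using E src
      by (auto simp: PiE_iff generated_by_initial_topology
          intro!: continuous_map_from_initial_topology continuous_map_into_initial_topology)
    then show "\<exists>lift. ?lift lift" ..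
  next
    fix p q assume "?lift p" "?lift q"
    moreover obtain L f L' f' where pq: "p = (L, f)" "q = (L', f')"
      by (cases p, cases q)
    ultimately have l: "?lift (L, f)" "?lift (L', f')" by auto
    \<comment> \<open>For uniqueness, the universal property of \<open>M\<close> is tested on the
      identity of \<open>E\<close> out of \<open>M'\<close>: composing it with \<open>g i\<close>
      gives \<open>g i\<close> on \<open>E\<close>, which is continuous on
      \<open>M'\<close>.\<close>
    have finer: "continuous_map M' M (\<lambda>x\<in>E. x)"
      if M: "?lift (M, u)" and M': "?lift (M', u')" for M M' u u'
    proof -
      have "continuous_map M' (D i) (g i \<circ> (\<lambda>x\<in>E. x))" if "i \<in> I" for i
        using M' that unfolding initial_lift_forget_gen_iff
        by (auto elim!: continuous_map_eq)
      moreover have "(\<lambda>x\<in>E. x) \<in> topspace M' \<rightarrow>\<^sub>E E"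
        "topspace M' \<in> \<U>" "generated_by \<B> M'"
        using M' unfolding initial_lift_forget_gen_iff by auto
      ultimately show ?thesis
        using M unfolding initial_lift_forget_gen_iff by blast
    qed
    have sub: "openin M' V" if M: "?lift (M, u)" and M': "?lift (M', u')" and V: "openin M V"
      for M M' u u' V
    proof -
      have "topspace M = E" "topspace M' = E"
        using M M' unfolding initial_lift_forget_gen_iff by auto
      moreover from this have "{x \<in> topspace M'. (\<lambda>x\<in>E. x) x \<in> V} = V"
        using openin_subset[OF V] by auto
      ultimately show ?thesis
        using openin_continuous_map_preimage[OF finer[OF M M'] V] by simp
    qed
    have "L = L'"
      unfolding topology_eq using sub[OF l] sub[OF l(2,1)] by blast
    with l show "p = q"
      unfolding pq initial_lift_forget_gen_iff by simp
  qed
qed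

section \<open>Smallness of the fibres\<close>

lemma small_wrt_lepoll:
  assumes "set_universe \<U>" "small_wrt \<U> Y" "X \<lesssim> Y"
  shows "small_wrt \<U> X"
proof -
  obtain S where "S \<in> \<U>" "Y \<approx> S"
    using assms(2) by (auto simp: small_wrt_def)
  then have "X \<lesssim> S"
    using assms(3) lepoll_trans2 by blast
  \<comment> \<open>The image of the injection is a subset of a member of \<U>, hence itself a
    member, and it is equipollent to \<open>X\<close>.\<close>
  then obtain h where "inj_on h X" "h ` X \<subseteq> S"
    by (auto simp: lepoll_def)
  then have "h ` X \<subseteq> S" "X \<approx> h ` X"
    by (auto simp: eqpoll_def bij_betw_def)
  moreover from this \<open>S \<in> \<U>\<close> have "h ` X \<in> \<U>"
    using assms(1) unfolding set_universe_def by blast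
  ultimately show ?thesis
    unfolding small_wrt_def by blast
qed

lemma small_wrt_Pow:
  assumes "set_universe \<U>" "small_wrt \<U> X"
  shows "small_wrt \<U> (Pow X)"
proof -
  obtain S where S: "S \<in> \<U>" "X \<approx> S"
    using assms(2) by (auto simp: small_wrt_def)
  then obtain f where "bij_betw f X S"
    by (auto simp: eqpoll_def)
  \<comment> \<open>\<open>Pow S\<close> lives one type higher than \<U>, so the universe supplies
    an equipollent member in its place.\<close>
  then have "Pow X \<approx> Pow S"
    unfolding eqpoll_def by (blast intro: bij_betw_Pow)
  then show ?thesis
    using S(1) assms(1) unfolding small_wrt_def set_universe_def by (meson eqpoll_trans)
qed

lemma fibre_small_forget_gen:
  assumes "set_universe \<U>"
  shows "fibre_small \<U> (Top_gen \<U> \<B>) (Set_cat \<U>) forget_gen"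
  unfolding fibre_small_def
proof
  fix E assume "E \<in> Obj (Set_cat \<U>)"
  then have "small_wrt \<U> E"
    by (auto simp: Set_cat_def small_wrt_def)
  then have small: "small_wrt \<U> (Pow (Pow E))"
    using assms by (intro small_wrt_Pow)
  \<comment> \<open>A topology is determined by its open sets, so the topologies on \<open>E\<close>
    embed into \<open>Pow (Pow E)\<close>.\<close>
  have "inj_on (\<lambda>X. Collect (openin X)) A" for A :: "'a topology set"
    by (auto simp: inj_on_def topology_eq)
  moreover have "(\<lambda>X. Collect (openin X)) ` {X. topspace X = E} \<subseteq> Pow (Pow E)"
    using openin_subset by auto
  ultimately have "{X. topspace X = E} \<lesssim> Pow (Pow E)"
    unfolding lepoll_def by blast
  moreover have "{a \<in> Obj (Top_gen \<U> \<B>). FObj forget_gen a = E} \<lesssim> {X. topspace X = E}"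
    by (rule subset_imp_lepoll) (auto simp: forget_gen_def)
  ultimately show "small_wrt \<U> {a \<in> Obj (Top_gen \<U> \<B>). FObj forget_gen a = E}"
    using small_wrt_lepoll[OF assms small] lepoll_trans by blast
qed

theorem proposition2p9:
  fixes \<U> :: "'u set set" and \<B> :: "'u topology set"
  assumes universe: "set_universe \<U>"
    and subcategory: "\<B> \<subseteq> Obj (Top_cat \<U>)"
    and compact: "\<And>B. B \<in> \<B> \<Longrightarrow> compact_space B \<and> Hausdorff_space B"
    and simplices: "\<And>n. \<exists>B\<in>\<B>. B homeomorphic_space top_simplex n"
    and products: "\<And>B B'. B \<in> \<B> \<Longrightarrow> B' \<in> \<B> \<Longrightarrow> generated_by \<B> (prod_topology B B')"
  shows "topological_functor TYPE('i) (Top_gen \<U> \<B>) (Set_cat \<U>) forget_gen \<and>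
         fibre_small \<U> (Top_gen \<U> \<B>) (Set_cat \<U>) forget_gen"
  using topological_functor_forget_gen fibre_small_forget_gen[OF universe] by blast

end
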